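(* Let $K$ be any field of characteristic $0$, and let $\phi: x\to u,\ y\to v$ be a birational morphism of the affine plane $A^2$ over $K$. If $\phi$ is a product of simple affine contractions, then the sum of the degrees of $u$ and $v$ can be decreased by a single generalized simple affine contraction.
   Context: $K[x,y]$ is the polynomial algebra in two variables over $K$, and $A^2$ is the affine plane over $K$. The degree is the degree of a polynomial in $K[x,y]$. A birational morphism of $A^2$ over $K$ is a mapping $A^2\to A^2$ given by a polynomial mapping $\varphi$ of the algebra $K[x,y]$ such that, for the quotient fields, $K(\varphi(x),\varphi(y))=K(x,y)$; it is written $x\to\varphi(x),\ y\to\varphi(y)$. A simple affine contraction is either a polynomial automorphism of $K[x,y]$ or the mapping $\tau_x: x\to x,\ y\to xy$. "Product" means a composition of such mappings. A generalized simple affine contraction is any of the following transformations, applied to pairs $(u,v)\in K[x,y]\times K[x,y]$: (ET1) $(u,v)\longrightarrow\left(\frac{u+a}{c\cdot v+b},\,v\right)$ for arbitrary $a,b,c\in K$, with the denominator not $0$; (ET1$'$) $(u,v)\longrightarrow\left(u,\,\frac{v+a}{c\cdot u+b}\right)$ for arbitrary $a,b,c\in K$, with the denominator not $0$; (ET2) $(u,v)\longrightarrow(u+q(v),\,v)$ for an arbitrary polynomial $q(v)$; (ET2$'$) $(u,v)\longrightarrow(u,\,v+q(u))$ for an arbitrary polynomial $q(u)$; (ET3) $(u,v)\longrightarrow(v,u)$. Transformations (ET1) and (ET1$'$) are applied only if the corresponding ratio is a polynomial.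
   Formalization: The sum of the degrees of u and v is assumed to be greater than 2; when it equals 2 (affine automorphisms, e.g. u = x, v = y) no generalized simple affine contraction can decrease it, so the claim fails there. *)

theory Defs
  imports "HOL-Computational_Algebra.Computational_Algebra"
begin

text \<open>
  The algebra \<open>K[x,y]\<close> is realised as \<open>K[x][y]\<close>: in \<open>p :: 'a poly poly\<close> the outer variable is
  \<open>y\<close> and the coefficients are polynomials in \<open>x\<close>, so that \<open>coeff (coeff p j) i\<close> is the
  coefficient of \<open>x\<^sup>i y\<^sup>j\<close>.
\<close>

type_synonym 'a bpoly = "'a poly poly"

definition const_xy :: "'a::field \<Rightarrow> 'a bpoly" where
  "const_xy a = [:[:a:]:]"

definition var_x :: "'a::field bpoly" where
  "var_x = [:[:0, 1:]:]"

definition var_y :: "'a::field bpoly" where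
  "var_y = [:0, 1:]"

text \<open>
  Total degree, as opposed to the library's \<open>degree\<close>, which on this type is only the degree
  in \<open>y\<close>. The zero polynomial gets degree \<open>0\<close>.
\<close>

definition total_degree :: "'a::field bpoly \<Rightarrow> nat" where
  "total_degree p = Max (insert 0 {i + j | i j. coeff (coeff p j) i \<noteq> 0})"

definition subst1 :: "'a::field poly \<Rightarrow> 'a bpoly \<Rightarrow> 'a bpoly" where
  "subst1 q w = poly (map_poly const_xy q) w"

definition alg_endo :: "('a::field bpoly \<Rightarrow> 'a bpoly) \<Rightarrow> bool" where
  "alg_endo f \<longleftrightarrow>
     (\<forall>p q. f (p + q) = f p + f q) \<and>
     (\<forall>p q. f (p * q) = f p * f q) \<and>
     (\<forall>a. f (const_xy a) = const_xy a)"

definition alg_auto :: "('a::field bpoly \<Rightarrow> 'a bpoly) \<Rightarrow> bool" where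
  "alg_auto f \<longleftrightarrow> alg_endo f \<and> bij f"

text \<open>The subfield \<open>K(u,v)\<close> of the quotient field \<open>K(x,y)\<close> of \<open>K[x,y]\<close>.\<close>

inductive_set gen_subfield :: "'a::field bpoly \<Rightarrow> 'a bpoly \<Rightarrow> 'a bpoly fract set"
  for u v where
  gen_const: "to_fract (const_xy a) \<in> gen_subfield u v"
| gen_fst: "to_fract u \<in> gen_subfield u v"
| gen_snd: "to_fract v \<in> gen_subfield u v"
| gen_add: "r \<in> gen_subfield u v \<Longrightarrow> s \<in> gen_subfield u v \<Longrightarrow> r + s \<in> gen_subfield u v"
| gen_uminus: "r \<in> gen_subfield u v \<Longrightarrow> - r \<in> gen_subfield u v"
| gen_mult: "r \<in> gen_subfield u v \<Longrightarrow> s \<in> gen_subfield u v \<Longrightarrow> r * s \<in> gen_subfield u v"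
| gen_inverse: "r \<in> gen_subfield u v \<Longrightarrow> inverse r \<in> gen_subfield u v"

definition birational_morphism :: "('a::field bpoly \<Rightarrow> 'a bpoly) \<Rightarrow> bool" where
  "birational_morphism f \<longleftrightarrow>
     alg_endo f \<and> gen_subfield (f var_x) (f var_y) = gen_subfield var_x var_y"

text \<open>
  The substitution \<open>x \<rightarrow> x, y \<rightarrow> x y\<close>; since it fixes \<open>x\<close>, it is a composition of
  polynomials in \<open>y\<close> over \<open>K[x]\<close>.
\<close>

definition tau_x :: "'a::field bpoly \<Rightarrow> 'a bpoly" where
  "tau_x p = pcompose p (var_x * var_y)"

lemma tau_x_var_x: "tau_x var_x = var_x"
  by (simp add: tau_x_def var_x_def)

lemma tau_x_var_y: "tau_x var_y = var_x * var_y"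
  by (simp add: tau_x_def var_y_def pcompose_pCons)

lemma alg_endo_tau_x: "alg_endo tau_x"
  by (simp add: alg_endo_def tau_x_def const_xy_def pcompose_add pcompose_mult)

lemma gen_subfield_var_xy: "gen_subfield var_x var_y = (UNIV :: 'a::field bpoly fract set)"
proof -
  let ?G = "gen_subfield var_x var_y :: 'a bpoly fract set"
  have x: "to_fract [:p:] \<in> ?G" for p :: "'a poly"
  proof (induction p)
    case 0
    show ?case using gen_const[of 0 var_x var_y] by (simp add: const_xy_def)
  next
    case (pCons a p)
    have "[:pCons a p:] = const_xy a + var_x * [:p:]"
      by (simp add: const_xy_def var_x_def)
    then show ?case
      using gen_add[OF gen_const gen_mult[OF gen_fst pCons.IH]]
      by (simp only: to_fract_add to_fract_mult)
  qed
  have y: "to_fract p \<in> ?G" for p :: "'a bpoly"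
  proof (induction p)
    case 0
    show ?case using x[of 0] by simp
  next
    case (pCons c p)
    have "pCons c p = [:c:] + var_y * p"
      by (simp add: var_y_def)
    then show ?case
      using gen_add[OF x gen_mult[OF gen_snd pCons.IH]]
      by (simp only: to_fract_add to_fract_mult)
  qed
  have "r \<in> ?G" for r :: "'a bpoly fract"
  proof (cases r)
    case (Fract a b)
    then have "r = to_fract a * inverse (to_fract b)"
      by (simp add: to_fract_def)
    then show ?thesis using gen_mult[OF y gen_inverse[OF y]] by simp
  qed
  then show ?thesis by blast
qed

definition simple_affine_contraction :: "('a::field bpoly \<Rightarrow> 'a bpoly) \<Rightarrow> bool" where
  "simple_affine_contraction f \<longleftrightarrow> alg_auto f \<or> f = tau_x"

inductive product_of_contractions :: "('a::field bpoly \<Rightarrow> 'a bpoly) \<Rightarrow> bool" where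
  single: "simple_affine_contraction f \<Longrightarrow> product_of_contractions f"
| comp: "simple_affine_contraction f \<Longrightarrow> product_of_contractions g \<Longrightarrow>
    product_of_contractions (f \<circ> g)"

text \<open>
  \<open>gen_contraction (u, v) (u', v')\<close> means that \<open>(u', v')\<close> arises from \<open>(u, v)\<close> by one generalized
  simple affine contraction. The quotients are exact because of the divisibility premises.
\<close>

inductive gen_contraction ::
  "'a::field bpoly \<times> 'a bpoly \<Rightarrow> 'a bpoly \<times> 'a bpoly \<Rightarrow> bool" where
  ET1: "const_xy c * v + const_xy b \<noteq> 0 \<Longrightarrow>
    (const_xy c * v + const_xy b) dvd (u + const_xy a) \<Longrightarrow>
    gen_contraction (u, v) ((u + const_xy a) div (const_xy c * v + const_xy b), v)"
| ET1': "const_xy c * u + const_xy b \<noteq> 0 \<Longrightarrow>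
    (const_xy c * u + const_xy b) dvd (v + const_xy a) \<Longrightarrow>
    gen_contraction (u, v) (u, (v + const_xy a) div (const_xy c * u + const_xy b))"
| ET2: "gen_contraction (u, v) (u + subst1 q v, v)"
| ET2': "gen_contraction (u, v) (u, v + subst1 q u)"
| ET3: "gen_contraction (u, v) (v, u)"

end

theory Submission
  imports Defs
begin

text \<open>
  The pairs \<open>(\<phi> x, \<phi> y)\<close> of products \<open>\<phi>\<close> are built from \<open>(x, y)\<close> by right multiplication with
  \<open>\<tau>\<^sub>x\<close>, that is \<open>(u, v) \<rightarrow> (u, u v)\<close>, and with automorphisms. Call a pair \<open>ascending\<close> if it can be
  reached from an affine coordinate system by inverse generalized contractions that raise the
  total degree at every single step. The last step of such an ascent, read backwards, is the
  contraction sought (\<open>ascending_reducible\<close>); so it suffices that every product leads to an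
  ascending pair.

  Multiplication by \<open>u\<close> always raises the degree, hence \<open>\<tau>\<^sub>x\<close> preserves ascending pairs. For
  automorphisms there are two ingredients.

  The first is peak reduction (\<open>ascending_flexible\<close>): ascending pairs are closed under arbitrary
  elementary moves \<open>(u, v) \<rightarrow> (u, v + q(u))\<close> and scalings, also those that do not raise the
  degree. If the move and the last step of the ascent change the same coordinate, they commute
  or merge. If they change different coordinates and the move does not raise the degree, then,
  translations aside, both polynomials involved are linear and the degrees of \<open>u\<close> and \<open>v\<close> agree, so the peak can be
  cut off by linear moves among pairs of smaller degree.

  The second is the theorem of Jung and van der Kulk in the form needed here: a pair \<open>(a, b)\<close> that
  generates \<open>K[x,y]\<close> and is not affine admits an elementary move that lowers the degree. The
  Jacobian of such a pair is constant, so the leading forms are dependent; if one degree divides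
  the other, a multiple of a power of one leading form is the other one (\<open>top_form_cancel\<close>). That
  one degree does divide the other (\<open>degrees_dvd\<close>) is a degree estimate: write \<open>x = G(a, b)\<close> and
  let \<open>W\<close> be the largest weighted degree of a monomial of \<open>G\<close>. If the top part of \<open>G\<close> has \<open>N + 1\<close>
  monomials, then \<open>N\<close> derivations along \<open>a\<close> isolate one of them, and each raises the degree of
  the value by at most \<open>deg a + deg b - 2\<close>. Hence \<open>W \<le> 1 + N (deg a + deg b - 2)\<close>, whereas \<open>N + 1\<close>
  monomials of equal weight force \<open>W \<ge> N lcm (deg a, deg b)\<close>.
\<close>

section \<open>Total degree and substitution\<close>

lemma map_poly_add_hom:
  fixes f :: "'a::comm_ring_1 \<Rightarrow> 'b::comm_ring_1"
  assumes "f 0 = 0" "\<And>a b. f (a + b) = f a + f b"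
  shows "map_poly f (p + q) = map_poly f p + map_poly f q"
  by (intro poly_eqI) (simp add: coeff_map_poly assms)

lemma map_poly_mult_hom:
  fixes f :: "'a::comm_ring_1 \<Rightarrow> 'b::comm_ring_1"
  assumes f: "f 0 = 0" "\<And>a b. f (a + b) = f a + f b" "\<And>a b. f (a * b) = f a * f b"
  shows "map_poly f (p * q) = map_poly f p * map_poly f q"
proof (induction p)
  case (pCons a p)
  have "map_poly f (smult a q) = smult (f a) (map_poly f q)"
    by (intro poly_eqI) (simp add: coeff_map_poly f)
  then show ?case
    using pCons by (simp add: map_poly_add_hom f map_poly_pCons)
qed simp

text \<open>
  The substitution \<open>x \<rightarrow> t, y \<rightarrow> t y\<close> with \<open>t\<close> as the new outer variable. It turns the total degree
  into the ordinary degree in \<open>t\<close> and the leading form into the leading coefficient, dehomogenized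
  at \<open>x = 1\<close>; this makes the arithmetic of degrees in integral domains available for total degrees.
\<close>
definition radial :: "'a::field bpoly \<Rightarrow> 'a bpoly" where
  "radial p = poly (map_poly (map_poly (\<lambda>a. [:a:])) p) [:0, [:0, 1:]:]"

lemma radial_pCons: "radial (pCons q p) = map_poly (\<lambda>a. [:a:]) q + pCons 0 (smult [:0, 1:] (radial p))"
  by (simp add: radial_def map_poly_pCons)

lemma radial_0 [simp]: "radial 0 = 0" by (simp add: radial_def)

lemma radial_add: "radial (p + q) = radial p + radial q"
  by (simp add: radial_def map_poly_add_hom)

lemma radial_mult: "radial (p * q) = radial p * radial q"
  by (simp add: radial_def map_poly_mult_hom map_poly_add_hom)

lemma coeff_radial:
  "coeff (coeff (radial p) k) j = (if j \<le> k then coeff (coeff p j) (k - j) else 0)"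
proof (induction p arbitrary: k j)
  case (pCons q p)
  show ?case
    by (cases k; cases j) (auto simp: radial_pCons coeff_map_poly pCons.IH coeff_pCons)
qed simp

lemma total_degree_eq: "total_degree p = degree (radial p)"
proof -
  let ?E = "{i + j | i j. coeff (coeff p j) i \<noteq> 0}"
  have mem: "k \<in> ?E \<longleftrightarrow> coeff (radial p) k \<noteq> 0" for k
  proof
    assume "k \<in> ?E"
    then obtain i j where "k = i + j" "coeff (coeff p j) i \<noteq> 0" by blast
    then have "coeff (coeff (radial p) k) j \<noteq> 0" by (simp add: coeff_radial)
    then show "coeff (radial p) k \<noteq> 0" by auto
  next
    assume "coeff (radial p) k \<noteq> 0"
    then obtain j where "coeff (coeff (radial p) k) j \<noteq> 0" by (auto simp: poly_eq_iff)
    then have "j \<le> k" "coeff (coeff p j) (k - j) \<noteq> 0" by (auto simp: coeff_radial split: if_splits)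
    then show "k \<in> ?E" by (intro CollectI exI[of _ "k - j"] exI[of _ j]) simp
  qed
  then have le: "k \<in> ?E \<Longrightarrow> k \<le> degree (radial p)" for k
    by (simp add: le_degree)
  then have fin: "finite ?E" by (meson finite_nat_set_iff_bounded_le)
  show ?thesis
    unfolding total_degree_def
  proof (rule Max_eqI)
    show "degree (radial p) \<in> insert 0 ?E"
      using mem[of "degree (radial p)"] by (cases "radial p = 0") auto
  qed (use fin le in auto)
qed

lemma radial_const [simp]: "radial (const_xy a) = [:[:a:]:]"
  by (simp add: const_xy_def radial_pCons map_poly_pCons)
lemma radial_1 [simp]: "radial 1 = 1"
  using radial_const[of 1] by (simp add: const_xy_def one_pCons)
lemma radial_var_x [simp]: "radial var_x = [:0, 1:]"
  by (simp add: var_x_def radial_pCons map_poly_pCons one_pCons)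
lemma radial_var_y [simp]: "radial var_y = [:0, [:0, 1:]:]"
  by (simp add: var_y_def radial_pCons map_poly_pCons one_pCons)

lemma radial_eq_0_iff [simp]: "radial p = 0 \<longleftrightarrow> p = 0"
proof
  assume "radial p = 0"
  then have "coeff (coeff p j) i = 0" for i j using coeff_radial[of p "i + j" j] by simp
  then show "p = 0" by (simp add: poly_eq_iff)
qed simp

lemma total_degree_mult:
  "p \<noteq> 0 \<Longrightarrow> q \<noteq> 0 \<Longrightarrow> total_degree (p * q) = total_degree p + total_degree q"
  by (simp add: total_degree_eq radial_mult degree_mult_eq)

lemma total_degree_const [simp]: "total_degree (const_xy a) = 0"
  by (simp add: total_degree_eq)

lemma total_degree_add_le: "total_degree (p + q) \<le> max (total_degree p) (total_degree q)"
  by (simp add: total_degree_eq radial_add degree_add_le_max)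

lemma total_degree_add_left:
  "total_degree q < total_degree p \<Longrightarrow> total_degree (p + q) = total_degree p"
  by (simp add: total_degree_eq radial_add degree_add_eq_left)

lemma total_degree_add_const [simp]: "total_degree (p + const_xy a) = total_degree p"
proof (cases "total_degree p = 0")
  case True
  then show ?thesis using total_degree_add_le[of p "const_xy a"] by simp
qed (simp add: total_degree_add_left)

lemma total_degree_eq_0:
  assumes "total_degree p = 0" obtains a where "p = const_xy a"
proof -
  have "coeff (coeff p j) i = 0" if "i + j > 0" for i j
    using that assms coeff_radial[of p "i + j" j] by (simp add: total_degree_eq coeff_eq_0)
  then have "p = const_xy (coeff (coeff p 0) 0)"
    by (auto simp: poly_eq_iff const_xy_def coeff_pCons split: nat.split)
  then show ?thesis by (rule that)
qed

lemma const_xy_0 [simp]: "const_xy 0 = 0" by (simp add: const_xy_def)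
lemma const_xy_1 [simp]: "const_xy 1 = 1" by (simp add: const_xy_def one_pCons)
lemma const_xy_eq_0_iff [simp]: "const_xy a = 0 \<longleftrightarrow> a = 0" by (simp add: const_xy_def)
lemma const_xy_add: "const_xy (a + b) = const_xy a + const_xy b" by (simp add: const_xy_def)
lemma const_xy_mult: "const_xy (a * b) = const_xy a * const_xy b" by (simp add: const_xy_def)
lemma const_xy_uminus: "const_xy (- a) = - const_xy a" by (simp add: const_xy_def)

lemma total_degree_scale [simp]: "a \<noteq> 0 \<Longrightarrow> total_degree (const_xy a * p) = total_degree p"
  by (cases "p = 0") (simp_all add: total_degree_mult)

lemma subst1_0 [simp]: "subst1 0 w = 0" by (simp add: subst1_def)
lemma subst1_pCons: "subst1 (pCons a q) w = const_xy a + w * subst1 q w"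
  by (simp add: subst1_def map_poly_pCons)
lemma subst1_add: "subst1 (p + q) w = subst1 p w + subst1 q w"
  by (simp add: subst1_def map_poly_add_hom const_xy_add)
lemma subst1_mult: "subst1 (p * q) w = subst1 p w * subst1 q w"
  by (simp add: subst1_def map_poly_mult_hom const_xy_add const_xy_mult)
lemma subst1_const [simp]: "subst1 [:a:] w = const_xy a" by (simp add: subst1_pCons)
lemma subst1_uminus: "subst1 (- p) w = - subst1 p w"
  using subst1_add[of p "- p" w] by (simp add: eq_neg_iff_add_eq_0 add.commute)
lemma subst1_pcompose: "subst1 (pcompose p q) w = subst1 p (subst1 q w)"
  by (induction p) (simp_all add: pcompose_pCons subst1_pCons subst1_add subst1_mult)

text \<open>
  A polynomial in one nonconstant element has no cancellation among its terms. Nonvanishing is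
  part of the induction because the degree of \<open>0\<close> is \<open>0\<close> by convention.
\<close>
lemma total_degree_subst1_aux:
  assumes "total_degree u > 0"
  shows "q \<noteq> 0 \<Longrightarrow> subst1 q u \<noteq> 0 \<and> total_degree (subst1 q u) = degree q * total_degree u"
proof (induction q)
  case (pCons a q)
  show ?case
  proof (cases "q = 0")
    case False
    then have IH: "subst1 q u \<noteq> 0" "total_degree (subst1 q u) = degree q * total_degree u"
      using pCons by auto
    moreover have "u \<noteq> 0" using assms by (auto simp: total_degree_eq)
    ultimately have d: "total_degree (u * subst1 q u) = total_degree u + degree q * total_degree u"
      by (simp add: total_degree_mult)
    have "total_degree (const_xy a + u * subst1 q u) = total_degree u + degree q * total_degree u"
      using d total_degree_add_const[of "u * subst1 q u" a] by (simp add: add.commute)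
    moreover from this have "const_xy a + u * subst1 q u \<noteq> 0"
      using assms by (auto simp: total_degree_eq)
    ultimately show ?thesis using False by (simp add: subst1_pCons)
  qed (use pCons in auto)
qed simp

lemma subst1_scaled:
  assumes "c \<noteq> 0" obtains q' where "subst1 q w = subst1 q' (const_xy c * w)"
proof
  show "subst1 q w = subst1 (pcompose q [:0, 1 / c:]) (const_xy c * w)"
    using assms by (simp add: subst1_pcompose subst1_pCons const_xy_mult[symmetric] mult.assoc[symmetric])
      (metis const_xy_mult const_xy_1 mult.assoc mult.commute mult_1 nonzero_eq_divide_eq)
qed

lemma subst1_translated:
  obtains q' where "subst1 q w = subst1 q' (w + const_xy c)"
proof
  show "subst1 q w = subst1 (pcompose q [:- c, 1:]) (w + const_xy c)"
    by (simp add: subst1_pcompose subst1_pCons const_xy_uminus)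
qed

text \<open>
  Division by \<open>X + b\<close> with remainder; it lets an elementary move pass through the inverse of a
  contraction with denominator \<open>w + b\<close>.
\<close>
lemma subst1_remainder:
  obtains r d where "subst1 q w = subst1 r w * (w + const_xy b) + const_xy d"
proof -
  have "[:b, 1:] dvd q - [:poly q (- b):]"
    using poly_eq_0_iff_dvd[of "q - [:poly q (- b):]" "- b"] by simp
  then obtain r where "q - [:poly q (- b):] = [:b, 1:] * r" by (elim dvdE)
  then have "q = r * [:b, 1:] + [:poly q (- b):]" by (simp add: algebra_simps)
  then have "subst1 q w = subst1 r w * (w + const_xy b) + const_xy (poly q (- b))"
    by (metis (no_types) subst1_add subst1_mult subst1_pCons subst1_const subst1_0 mult_zero_right
        add_0_right const_xy_1 mult_1_right add.commute)
  then show ?thesis by (rule that)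
qed

section \<open>The Jacobian bracket\<close>

definition jac :: "'a::field bpoly \<Rightarrow> 'a bpoly \<Rightarrow> 'a bpoly" where
  "jac U V = pderiv U * map_poly pderiv V - map_poly pderiv U * pderiv V"

text \<open>
  The Jacobian determinant of \<open>a\<close> and \<open>b\<close> with respect to \<open>x, y\<close>, pulled back along \<open>radial\<close> and
  multiplied by \<open>t\<close>, the functional determinant of that substitution. As a function of each
  argument it is a derivation along \<open>radial\<close>.
\<close>
definition bracket :: "'a::field bpoly \<Rightarrow> 'a bpoly \<Rightarrow> 'a bpoly" where
  "bracket a b = jac (radial a) (radial b)"

lemma map_pderiv_add: "map_poly pderiv (p + q) = map_poly pderiv p + map_poly pderiv (q :: 'a::field bpoly)"
  by (simp add: map_poly_add_hom pderiv_add)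

lemma map_pderiv_mult:
  "map_poly pderiv (p * q) = p * map_poly pderiv q + map_poly pderiv p * (q :: 'a::field bpoly)"
proof (induction p)
  case (pCons a p)
  have "map_poly pderiv (smult a q) = smult a (map_poly pderiv q) + smult (pderiv a) q"
    by (intro poly_eqI) (simp add: coeff_map_poly pderiv_mult algebra_simps)
  then show ?case
    using pCons by (simp add: map_pderiv_add map_poly_pCons pderiv_0 algebra_simps)
qed simp

lemma bracket_add: "bracket a (p + q) = bracket a p + bracket a q"
  by (simp add: bracket_def jac_def radial_add map_pderiv_add pderiv_add algebra_simps)

lemma bracket_mult: "bracket a (p * q) = radial p * bracket a q + bracket a p * radial q"
  by (simp add: bracket_def jac_def radial_mult map_pderiv_mult pderiv_mult algebra_simps)

lemma bracket_const [simp]: "bracket a (const_xy c) = 0"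
  by (simp add: bracket_def jac_def map_poly_pCons)

lemma bracket_0 [simp]: "bracket a 0 = 0" using bracket_const[of a 0] by simp

lemma bracket_self [simp]: "bracket a a = 0"
  by (simp add: bracket_def jac_def)

lemma bracket_swap: "bracket b a = - bracket a b"
  by (simp add: bracket_def jac_def mult.commute)

lemma bracket_subst1 [simp]: "bracket a (subst1 q a) = 0"
  by (induction q) (simp_all add: subst1_pCons bracket_add bracket_mult)

lemma bracket_xy: "bracket var_x var_y = [:0, 1:]"
  by (simp add: bracket_def jac_def map_poly_pCons pderiv_pCons)

text \<open>
  The bracket carries the factor \<open>t\<close>: at \<open>t = 0\<close> every \<open>radial p\<close> is a constant.
\<close>
lemma bracket_degree_pos:
  assumes "bracket a b \<noteq> 0" shows "degree (bracket a b) > 0"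
proof -
  have c: "pderiv (coeff (radial p) 0) = 0" for p :: "'a bpoly"
    by (intro poly_eqI) (simp add: coeff_pderiv coeff_radial)
  have "coeff (bracket a b) 0 = 0"
    by (simp add: bracket_def jac_def coeff_mult coeff_map_poly c)
  then show ?thesis using assms
    by (metis degree_0_id gr0I pCons_0_0 coeff_0)
qed

lemma coeff_mult_bound:
  assumes "degree p \<le> a" "degree q \<le> b"
  shows "coeff (p * q) (a + b) = coeff p a * coeff (q :: 'a::comm_ring_1 poly) b"
proof -
  have "coeff (p * q) (a + b) = (\<Sum>i\<le>a + b. coeff p i * coeff q (a + b - i))" by (simp add: coeff_mult)
  also have "\<dots> = (\<Sum>i\<in>{a}. coeff p i * coeff q (a + b - i))"
  proof (rule sum.mono_neutral_right)
    show "\<forall>i\<in>{..a + b} - {a}. coeff p i * coeff q (a + b - i) = 0"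
    proof
      fix i assume "i \<in> {..a + b} - {a}"
      then consider "i > a" | "a + b - i > b" by fastforce
      then show "coeff p i * coeff q (a + b - i) = 0" using assms by cases (auto simp: coeff_eq_0)
    qed
  qed auto
  finally show ?thesis by simp
qed

lemma degree_map_pderiv: "degree (map_poly pderiv p) \<le> degree (p :: 'a::field bpoly)"
  by (rule map_poly_degree_leq)

text \<open>
  The usual bound \<open>deg J(a, b) \<le> deg a + deg b - 2\<close>, shifted by the factor \<open>t\<close>.
\<close>
lemma degree_bracket_le:
  assumes "bracket a b \<noteq> 0"
  shows "degree (bracket (a :: 'a::field_char_0 bpoly) b) + 1 \<le> total_degree a + total_degree b"
proof -
  let ?n = "total_degree a" and ?m = "total_degree b"
  have n: "?n > 0"
  proof (rule ccontr)
    assume "\<not> ?n > 0"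
    then obtain c where "a = const_xy c" using total_degree_eq_0 by blast
    then show False using assms bracket_swap[of a b] by simp
  qed
  have m: "?m > 0"
  proof (rule ccontr)
    assume "\<not> ?m > 0"
    then obtain c where "b = const_xy c" using total_degree_eq_0 by blast
    then show False using assms by simp
  qed
  have "degree (pderiv (radial a) * map_poly pderiv (radial b)) \<le> (?n - 1) + ?m"
    by (rule order_trans[OF degree_mult_le add_mono])
      (simp_all add: total_degree_eq degree_pderiv degree_map_pderiv)
  moreover have "degree (map_poly pderiv (radial a) * pderiv (radial b)) \<le> ?n + (?m - 1)"
    by (rule order_trans[OF degree_mult_le add_mono])
      (simp_all add: total_degree_eq degree_pderiv degree_map_pderiv)
  ultimately have "degree (bracket a b) \<le> ?n + ?m - 1"
    unfolding bracket_def jac_def using n m by (intro degree_diff_le) auto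
  then show ?thesis using n by simp
qed

text \<open>
  The possible leading coefficient of the bracket is a weighted Wronskian of the two leading
  forms, so it vanishes exactly when these are dependent.
\<close>
lemma coeff_bracket_top:
  fixes a b :: "'a::field_char_0 bpoly"
  assumes "total_degree a = n" "total_degree b = m" "n > 0" "m > 0"
  shows "coeff (bracket a b) (n + m - 1) =
    of_nat n * lead_coeff (radial a) * pderiv (lead_coeff (radial b))
    - of_nat m * pderiv (lead_coeff (radial a)) * lead_coeff (radial b)"
proof -
  have "coeff (pderiv (radial a) * map_poly pderiv (radial b)) ((n - 1) + m)
      = coeff (pderiv (radial a)) (n - 1) * coeff (map_poly pderiv (radial b)) m"
    by (rule coeff_mult_bound)
      (use assms in \<open>simp_all add: total_degree_eq degree_pderiv\<close>, metis degree_map_pderiv)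
  moreover have "coeff (map_poly pderiv (radial a) * pderiv (radial b)) (n + (m - 1))
      = coeff (map_poly pderiv (radial a)) n * coeff (pderiv (radial b)) (m - 1)"
    by (rule coeff_mult_bound)
      (use assms in \<open>simp_all add: total_degree_eq degree_pderiv\<close>, metis degree_map_pderiv)
  ultimately show ?thesis
    using assms by (simp add: bracket_def jac_def coeff_pderiv coeff_map_poly total_degree_eq algebra_simps)
qed



section \<open>Ascending pairs\<close>

lemma total_degree_pos:
  assumes "bracket u v \<noteq> 0"
  shows "total_degree u > 0" "total_degree v > 0"
proof -
  have "p = const_xy c \<Longrightarrow> bracket p q = 0" "p = const_xy c \<Longrightarrow> bracket q p = 0" for p q :: "'a bpoly" and c
    using bracket_swap[of p q] by auto
  then show "total_degree u > 0" "total_degree v > 0"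
    using assms by (metis total_degree_eq_0 gr0I)+
qed

lemma linear_polyE:
  assumes "degree p = 1" obtains a b where "p = [:a, b:]" "b \<noteq> 0"
proof
  show "p = [:coeff p 0, coeff p 1:]"
    using assms by (auto simp: poly_eq_iff coeff_pCons coeff_eq_0 split: nat.split)
  show "coeff p 1 \<noteq> 0" using assms by (metis leading_coeff_0_iff degree_0 zero_neq_one)
qed

text \<open>
  The inverses of (ET2') that raise the degree, and the inverses of (ET1') with the coefficient of
  \<open>u\<close> in the denominator normalized to \<open>1\<close>; the latter raise the degree whenever the pair has a
  nonzero Jacobian (\<open>total_degree_elementary_lift\<close>).
\<close>
definition elementary_lift :: "'a::field bpoly \<Rightarrow> 'a bpoly \<Rightarrow> 'a bpoly \<Rightarrow> bool" where
  "elementary_lift u v v' \<longleftrightarrow> (\<exists>q. v' = v + subst1 q u \<and> total_degree v < total_degree v')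
     \<or> (\<exists>a b. v' = v * (u + const_xy b) + const_xy a)"

inductive ascending :: "'a::field_char_0 bpoly \<Rightarrow> 'a bpoly \<Rightarrow> bool" where
  base: "total_degree u = 1 \<Longrightarrow> total_degree v = 1 \<Longrightarrow> bracket u v \<noteq> 0 \<Longrightarrow> ascending u v"
| right: "ascending u v \<Longrightarrow> elementary_lift u v v' \<Longrightarrow> ascending u v'"
| left: "ascending u v \<Longrightarrow> elementary_lift v u u' \<Longrightarrow> ascending u' v"

lemma ascending_swap: "ascending u v \<Longrightarrow> ascending v u"
proof (induction rule: ascending.induct)
  case (base u v)
  then show ?case using ascending.base[of v u] bracket_swap[of u v] by simp
qed (auto intro: ascending.intros)

lemma bracket_elementary_lift:
  assumes "bracket u v \<noteq> 0" "elementary_lift u v v'" shows "bracket u v' \<noteq> 0"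
proof -
  have "u + const_xy b \<noteq> 0" for b
    using total_degree_pos(1)[OF assms(1)] total_degree_add_const[of u b] by (auto simp: total_degree_eq)
  then have "radial (u + const_xy b) \<noteq> 0" for b
    by (simp only: radial_eq_0_iff not_False_eq_True)
  then show ?thesis
    using assms unfolding elementary_lift_def by (auto simp: bracket_add bracket_mult)
qed

lemma bracket_ascending: "ascending u v \<Longrightarrow> bracket u v \<noteq> 0"
proof (induction rule: ascending.induct)
  case (right u v v')
  then show ?case using bracket_elementary_lift by blast
next
  case (left u v u')
  then have "bracket v u' \<noteq> 0" using bracket_elementary_lift bracket_swap[of u v] by (metis neg_equal_0_iff_equal)
  then show ?case using bracket_swap[of v u'] by simp
qed

lemma total_degree_elementary_lift:
  assumes "bracket u v \<noteq> 0" "elementary_lift u v v'"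
  shows "total_degree v < total_degree v'"
  using assms(2) unfolding elementary_lift_def
proof (elim disjE exE conjE)
  fix a b assume v': "v' = v * (u + const_xy b) + const_xy a"
  note pos = total_degree_pos[OF assms(1)]
  have nz: "v \<noteq> 0" "u + const_xy b \<noteq> 0"
    using pos total_degree_add_const[of u b] by (auto simp: total_degree_eq)
  have "total_degree v' = total_degree v + total_degree u"
    unfolding v' by (simp add: total_degree_mult[OF nz])
  then show ?thesis using pos by simp
qed

lemma elementary_lift_scale_left:
  assumes "elementary_lift u v v'" "c \<noteq> 0"
  obtains d where "d \<noteq> 0" "elementary_lift (const_xy c * u) (const_xy d * v) v'"
proof -
  have k: "const_xy (1 / c) * const_xy c = 1" using assms(2) by (simp flip: const_xy_mult)
  consider q where "v' = v + subst1 q u" "total_degree v < total_degree v'"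
    | a b where "v' = v * (u + const_xy b) + const_xy a"
    using assms(1) unfolding elementary_lift_def by blast
  then show ?thesis
  proof cases
    case (1 q)
    obtain q' where "subst1 q u = subst1 q' (const_xy c * u)" using subst1_scaled assms(2) by blast
    then have "elementary_lift (const_xy c * u) (const_xy 1 * v) v'" using 1 unfolding elementary_lift_def by auto
    then show ?thesis using that by (metis one_neq_zero)
  next
    case (2 a b)
    have "v' = const_xy (1 / c) * v * (const_xy c * u + const_xy (c * b)) + const_xy a"
      using k 2 unfolding const_xy_mult by algebra
    then have "elementary_lift (const_xy c * u) (const_xy (1 / c) * v) v'" unfolding elementary_lift_def by blast
    then show ?thesis using that assms(2) by (metis divide_eq_0_iff one_neq_zero)
  qed
qed

lemma elementary_lift_scale_right:
  assumes "elementary_lift u v v'" "c \<noteq> 0" shows "elementary_lift u (const_xy c * v) (const_xy c * v')"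
  using assms(1) unfolding elementary_lift_def
proof (elim disjE exE conjE)
  fix q assume q: "v' = v + subst1 q u" "total_degree v < total_degree v'"
  have "const_xy c * v' = const_xy c * v + subst1 ([:c:] * q) u"
    unfolding q(1) subst1_mult by (simp add: algebra_simps)
  then show "(\<exists>q. const_xy c * v' = const_xy c * v + subst1 q u \<and>
      total_degree (const_xy c * v) < total_degree (const_xy c * v')) \<or>
      (\<exists>a b. const_xy c * v' = const_xy c * v * (u + const_xy b) + const_xy a)"
    using q(2) total_degree_scale[OF assms(2)] by metis
next
  fix a b assume "v' = v * (u + const_xy b) + const_xy a"
  then have "const_xy c * v' = const_xy c * v * (u + const_xy b) + const_xy (c * a)"
    by (simp add: const_xy_mult algebra_simps)
  then show "(\<exists>q. const_xy c * v' = const_xy c * v + subst1 q u \<and>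
      total_degree (const_xy c * v) < total_degree (const_xy c * v')) \<or>
      (\<exists>a b. const_xy c * v' = const_xy c * v * (u + const_xy b) + const_xy a)" by blast
qed

lemma elementary_lift_translate_left:
  assumes "elementary_lift u v v'" shows "elementary_lift (u + const_xy c) v v'"
  using assms unfolding elementary_lift_def
proof (elim disjE exE conjE)
  fix q assume q: "v' = v + subst1 q u" "total_degree v < total_degree v'"
  then show "(\<exists>q. v' = v + subst1 q (u + const_xy c) \<and> total_degree v < total_degree v') \<or>
      (\<exists>a b. v' = v * (u + const_xy c + const_xy b) + const_xy a)"
    by (metis subst1_translated)
next
  fix a b assume "v' = v * (u + const_xy b) + const_xy a"
  then have "v' = v * (u + const_xy c + const_xy (b + - c)) + const_xy a"
    unfolding const_xy_add const_xy_uminus by simp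
  then show "(\<exists>q. v' = v + subst1 q (u + const_xy c) \<and> total_degree v < total_degree v') \<or>
      (\<exists>a b. v' = v * (u + const_xy c + const_xy b) + const_xy a)" by blast
qed

text \<open>
  Closure under all scalings and elementary moves, in both coordinates so that the notion is
  symmetric in \<open>u\<close> and \<open>v\<close>.
\<close>
definition flexible :: "'a::field_char_0 bpoly \<Rightarrow> 'a bpoly \<Rightarrow> bool" where
  "flexible u v \<longleftrightarrow> (\<forall>c. c \<noteq> 0 \<longrightarrow> ascending (const_xy c * u) v \<and> ascending u (const_xy c * v))
     \<and> (\<forall>q. ascending u (v + subst1 q u) \<and> ascending (u + subst1 q v) v)"

lemma bracket_add_subst1: "bracket u (v + subst1 q u) = bracket u v"
  by (simp add: bracket_add)

text \<open>
  A scaling commutes with the last step of an ascent, up to a change of the parameters of that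
  step, and can therefore be applied before it.
\<close>
lemma ascending_scale_step:
  fixes u v :: "'a::field_char_0 bpoly"
  assumes uv: "ascending u v" and c: "c \<noteq> 0"
    and IH: "\<And>u' v' :: 'a bpoly. ascending u' v' \<Longrightarrow> total_degree u' + total_degree v' < total_degree u + total_degree v
      \<Longrightarrow> flexible u' v'"
  shows "ascending (const_xy c * u) v"
  using uv
proof cases
  case base
  have "bracket v (const_xy c * u) \<noteq> 0"
    using bracket_swap[of u v] c base by (simp add: bracket_mult)
  then have "bracket (const_xy c * u) v \<noteq> 0" using bracket_swap[of v "const_xy c * u"] by simp
  then show ?thesis using base c by (intro ascending.base) auto
next
  case (right v0)
  obtain d where d: "d \<noteq> 0" "elementary_lift (const_xy c * u) (const_xy d * v0) v"
    using elementary_lift_scale_left[OF right(2) c] .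
  have "total_degree v0 < total_degree v"
    using total_degree_elementary_lift bracket_ascending right by blast
  then have "ascending (const_xy c * u) v0" "flexible (const_xy c * u) v0"
    using IH[of u v0] IH[of "const_xy c * u" v0] right(1) c unfolding flexible_def by auto
  then have "ascending (const_xy c * u) (const_xy d * v0)" using d(1) unfolding flexible_def by blast
  then show ?thesis using d(2) ascending.right by blast
next
  case (left u0)
  have "bracket v u0 \<noteq> 0" using bracket_ascending[OF left(1)] bracket_swap[of v u0] by simp
  then have "total_degree u0 < total_degree u"
    using total_degree_elementary_lift left(2) by blast
  then have "ascending (const_xy c * u0) v"
    using IH[of u0 v] left(1) c unfolding flexible_def by auto
  then show ?thesis using ascending.left elementary_lift_scale_right[OF left(2) c] by blast
qed

text \<open>
  The peak reduction. A move that raises the degree is itself a step of an ascent. Otherwise the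
  last step \<open>s\<close> of the ascent to \<open>(u, v)\<close> is compared with the move. If \<open>s\<close> produced \<open>v\<close> from
  \<open>v\<^sub>0\<close>, the move is absorbed into a move of \<open>(u, v\<^sub>0)\<close>. Translations of \<open>v\<close> commute with
  steps that change \<open>u\<close>. If \<open>s\<close> produced \<open>u\<close> from \<open>u\<^sub>0\<close> and \<open>q\<close> is
  not constant, then \<open>deg u \<le> deg v\<close> because \<open>q(u)\<close> is no larger than \<open>v\<close>. Hence \<open>s\<close> is not a
  multiplication by \<open>v + b\<close>, and \<open>u = u\<^sub>0 + p(v)\<close> gives \<open>deg u \<ge> deg v\<close>. So \<open>p\<close> and \<open>q\<close> are linear
  and the target lies in the span of \<open>1, u\<^sub>0, v\<close>, where it is reached from the smaller
  pair \<open>(u\<^sub>0, v)\<close>.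
\<close>
lemma ascending_add_step:
  fixes u v :: "'a::field_char_0 bpoly"
  assumes uv: "ascending u v"
    and IH: "\<And>u' v' :: 'a bpoly. ascending u' v' \<Longrightarrow> total_degree u' + total_degree v' < total_degree u + total_degree v
      \<Longrightarrow> flexible u' v'"
  shows "ascending u (v + subst1 q u)"
proof (cases "total_degree (v + subst1 q u) > total_degree v")
  case True
  then show ?thesis using ascending.right[OF uv] unfolding elementary_lift_def by blast
next
  case False
  have nz: "bracket u v \<noteq> 0" using bracket_ascending[OF uv] .
  note pos = total_degree_pos[OF nz]
  have pos': "total_degree (v + subst1 q u) > 0"
    using total_degree_pos(2)[of u "v + subst1 q u"] nz by (simp add: bracket_add)
  show ?thesis using uv
  proof cases
    case base
    then show ?thesis using False pos' nz by (intro ascending.base) (auto simp: bracket_add)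
  next
    case (right v0)
    have less: "total_degree v0 < total_degree v"
      using total_degree_elementary_lift bracket_ascending right by blast
    then have flex: "flexible u v0" using IH right(1) by simp
    consider p where "v = v0 + subst1 p u" | a b where "v = v0 * (u + const_xy b) + const_xy a"
      using right(2) unfolding elementary_lift_def by blast
    then show ?thesis
    proof cases
      case (1 p)
      then have "v + subst1 q u = v0 + subst1 (p + q) u" by (simp add: subst1_add)
      then show ?thesis using flex unfolding flexible_def by simp
    next
      case (2 a b)
      obtain r d where "subst1 q u = subst1 r u * (u + const_xy b) + const_xy d"
        using subst1_remainder .
      then have "v + subst1 q u = (v0 + subst1 r u) * (u + const_xy b) + const_xy (a + d)"
        unfolding 2 const_xy_add by (simp add: algebra_simps)
      then have "elementary_lift u (v0 + subst1 r u) (v + subst1 q u)" unfolding elementary_lift_def by blast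
      then show ?thesis using flex ascending.right unfolding flexible_def by blast
    qed
  next
    case (left u0)
    have nz0: "bracket v u0 \<noteq> 0" using bracket_ascending[OF left(1)] bracket_swap[of v u0] by simp
    note pos0 = total_degree_pos(2)[OF nz0]
    have less: "total_degree u0 < total_degree u"
      using total_degree_elementary_lift[OF nz0] left(2) by blast
    then have flex: "flexible u0 v" using IH left(1) by simp
    show ?thesis
    proof (cases "degree q = 0")
      case True
      then obtain d where q: "q = [:d:]" by (metis degree_eq_zeroE)
      have "elementary_lift (v + subst1 q u) u0 u" using elementary_lift_translate_left[OF left(2)] by (simp add: q)
      moreover have "ascending u0 (v + subst1 q u)"
        using flex unfolding flexible_def q subst1_const by (metis subst1_const)
      ultimately show ?thesis by (rule ascending.left[rotated])
    next
      case deg: False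
      then have q0: "q \<noteq> 0" by auto
      have tdq: "total_degree (subst1 q u) = degree q * total_degree u"
        using total_degree_subst1_aux[OF pos(1) q0] by simp
      have "\<not> total_degree v < total_degree (subst1 q u)"
        using False total_degree_add_left[of v "subst1 q u"] by (auto simp: add.commute)
      then have qle: "degree q * total_degree u \<le> total_degree v" using tdq by simp
      moreover have "total_degree u \<le> degree q * total_degree u" using deg by simp
      ultimately have uv_le: "total_degree u \<le> total_degree v" by linarith
      consider p where "u = u0 + subst1 p v" | a b where "u = u0 * (v + const_xy b) + const_xy a"
        using left(2) unfolding elementary_lift_def by blast
      then show ?thesis
      proof cases
        case (2 a b)
        have "u0 \<noteq> 0" "v + const_xy b \<noteq> 0"
          using pos0 pos total_degree_add_const[of v b] by (auto simp: total_degree_eq)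
        then have "total_degree u = total_degree u0 + total_degree v"
          unfolding 2 by (simp add: total_degree_mult)
        then show ?thesis using uv_le pos0 by simp
      next
        case (1 p)
        have eq: "total_degree (subst1 p v) = total_degree u"
        proof -
          have "\<not> total_degree (subst1 p v) < total_degree u"
            using less total_degree_add_le[of u0 "subst1 p v"] by (auto simp: 1)
          moreover have "\<not> total_degree u < total_degree (subst1 p v)"
            using less total_degree_add_left[of u0 "subst1 p v"] by (auto simp: 1 add.commute)
          ultimately show ?thesis by simp
        qed
        have p0: "p \<noteq> 0"
          using eq pos(1) by (auto simp: total_degree_eq)
        then have tdp: "degree p * total_degree v = total_degree u"
          using eq total_degree_subst1_aux[OF pos(2)] by simp
        then have "degree p \<noteq> 0" using pos by (metis mult_0 less_irrefl)
        then have "degree p * total_degree v \<ge> total_degree v" by simp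
        then have same: "total_degree u = total_degree v" using tdp uv_le by linarith
        have "degree p = 1" using tdp same pos by simp
        then obtain \<alpha> \<beta> where p: "p = [:\<beta>, \<alpha>:]" "\<alpha> \<noteq> 0" by (rule linear_polyE)
        have "degree q = 1" using qle same pos deg by (cases "degree q") auto
        then obtain \<gamma> \<delta> where q: "q = [:\<delta>, \<gamma>:]" "\<gamma> \<noteq> 0" by (rule linear_polyE)
        have u: "u = u0 + const_xy \<alpha> * v + const_xy \<beta>"
          using 1 p by (simp add: subst1_pCons algebra_simps)
        have sum: "total_degree u0 + total_degree v < total_degree u + total_degree v" using less by simp
        (* w is the new second coordinate, and \<rho> its component along v modulo u0 and constants *)
        define w where "w = v + subst1 q u"
        define \<rho> \<kappa> where "\<rho> = 1 + \<gamma> * \<alpha>" and "\<kappa> = \<gamma> * \<beta> + \<delta>"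
        have w: "w = const_xy \<rho> * v + const_xy \<gamma> * u0 + const_xy \<kappa>"
          unfolding w_def \<rho>_def \<kappa>_def q u
          by (simp add: subst1_pCons const_xy_add const_xy_mult algebra_simps)
        show ?thesis
        proof (cases "\<rho> = 0")
          case True
          (* w has the degree of u0: the whole path from (u0, v) to (w, u) starts at small pairs *)
          have w': "w = const_xy \<gamma> * u0 + subst1 [:\<kappa>:] v" using w True by simp
          have "ascending (const_xy \<gamma> * u0) v" using flex q(2) unfolding flexible_def by blast
          then have "flexible (const_xy \<gamma> * u0) v" using IH sum q(2) by simp
          then have asc: "ascending w v" unfolding w' flexible_def by blast
          have tw: "total_degree w = total_degree u0" unfolding w' using q(2) by simp
          then have "flexible w v" using IH[OF asc] sum by simp
          then have asc: "ascending w (const_xy \<alpha> * v)" using p(2) unfolding flexible_def by blast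
          then have "flexible w (const_xy \<alpha> * v)" using IH[OF asc] sum tw p(2) by simp
          then have "ascending w (const_xy \<alpha> * v + subst1 [:\<beta> - \<kappa> / \<gamma>, 1 / \<gamma>:] w)"
            unfolding flexible_def by blast
          moreover have "const_xy \<alpha> * v + subst1 [:\<beta> - \<kappa> / \<gamma>, 1 / \<gamma>:] w = u"
          proof -
            have k: "const_xy (1 / \<gamma>) * const_xy \<gamma> = 1" using q(2) by (simp flip: const_xy_mult)
            have k': "const_xy (\<beta> - \<kappa> / \<gamma>) = const_xy \<beta> - const_xy (1 / \<gamma>) * const_xy \<kappa>"
              unfolding const_xy_mult[symmetric]
              by (simp add: const_xy_def)
            show ?thesis
              unfolding subst1_pCons k' w' u subst1_0 using k by (simp add: algebra_simps)
          qed
          ultimately show ?thesis using ascending_swap unfolding w_def by metis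
        next
          case False
          (* w has the degree of v, and u = u0 / \<rho> + (linear polynomial in w) is a degree-raising step *)
          have asc: "ascending u0 (const_xy \<rho> * v)" using flex False unfolding flexible_def by blast
          then have "flexible u0 (const_xy \<rho> * v)" using IH[OF asc] sum False by simp
          then have "ascending u0 (const_xy \<rho> * v + subst1 [:\<kappa>, \<gamma>:] u0)"
            unfolding flexible_def by blast
          moreover have "const_xy \<rho> * v + subst1 [:\<kappa>, \<gamma>:] u0 = w"
            by (simp add: w subst1_pCons algebra_simps)
          ultimately have asc: "ascending u0 w" by simp
          have "total_degree w \<le> total_degree v"
            using \<open>\<not> total_degree v < total_degree (v + subst1 q u)\<close> by (simp add: w_def)
          then have "flexible u0 w" using IH[OF asc] sum by simp
          then have "ascending (const_xy (1 / \<rho>) * u0) w"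
            using False unfolding flexible_def by (metis divide_eq_0_iff one_neq_zero)
          moreover have "elementary_lift w (const_xy (1 / \<rho>) * u0) u"
          proof -
            have k: "const_xy (1 / \<rho>) * const_xy \<rho> = 1" using False by (simp flip: const_xy_mult)
            have k1: "const_xy \<rho> = 1 + const_xy \<gamma> * const_xy \<alpha>"
              by (simp add: \<rho>_def const_xy_add const_xy_mult)
            have k2: "const_xy (\<beta> - \<alpha> * \<kappa> / \<rho>) = const_xy \<beta> - const_xy (1 / \<rho>) * const_xy \<alpha> * const_xy \<kappa>"
              unfolding const_xy_mult[symmetric] by (simp add: const_xy_def)
            have k3: "const_xy (\<alpha> / \<rho>) = const_xy (1 / \<rho>) * const_xy \<alpha>"
              unfolding const_xy_mult[symmetric] by simp
            have "u = const_xy (1 / \<rho>) * u0 + subst1 [:\<beta> - \<alpha> * \<kappa> / \<rho>, \<alpha> / \<rho>:] w"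
              unfolding subst1_pCons k2 k3 w u subst1_0 using k k1 by algebra
            moreover have "total_degree (const_xy (1 / \<rho>) * u0) < total_degree u"
              using False less by simp
            ultimately show ?thesis unfolding elementary_lift_def by blast
          qed
          ultimately show ?thesis using ascending.left unfolding w_def by blast
        qed
      qed
    qed
  qed
qed

lemma ascending_flexible: "ascending u v \<Longrightarrow> flexible u v"
proof (induction "total_degree u + total_degree v" arbitrary: u v rule: less_induct)
  case less
  have sw: "ascending v u" using less.prems ascending_swap by blast
  have IH: "flexible u' v'"
    if "ascending u' v'" "total_degree u' + total_degree v' < total_degree u + total_degree v" for u' v' :: "'a bpoly"
    using less.hyps that by blast
  have IH': "flexible u' v'"
    if "ascending u' v'" "total_degree u' + total_degree v' < total_degree v + total_degree u" for u' v' :: "'a bpoly"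
    using IH that by (simp add: add.commute)
  show ?case unfolding flexible_def
    using ascending_scale_step[OF less.prems _ IH] ascending_scale_step[OF sw _ IH']
      ascending_add_step[OF less.prems IH] ascending_add_step[OF sw IH']
    by (meson ascending_swap)
qed

lemma ascending_add: "ascending u v \<Longrightarrow> ascending u (v + subst1 q u)"
  and ascending_scale: "ascending u v \<Longrightarrow> c \<noteq> 0 \<Longrightarrow> ascending u (const_xy c * v)"
  using ascending_flexible unfolding flexible_def by blast+

text \<open>
  The last step of the ascent is undone by one generalized contraction; an affine pair, which has
  no last step, has degree sum \<open>2\<close>.
\<close>
lemma ascending_reducible:
  assumes "ascending u v" "total_degree u + total_degree v > 2"
  shows "\<exists>u' v'. gen_contraction (u, v) (u', v') \<and>
           total_degree u' + total_degree v' < total_degree u + total_degree v"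
proof -
  have *: "(\<exists>q. v0 = v + subst1 q u) \<or> (\<exists>a b. u + const_xy b \<noteq> 0 \<and> v + const_xy a = v0 * (u + const_xy b))"
    if "bracket u v0 \<noteq> 0" "elementary_lift u v0 v" for u v v0 :: "'a bpoly"
    using that(2) unfolding elementary_lift_def
  proof (elim disjE exE conjE)
    fix q assume "v = v0 + subst1 q u"
    then have "v0 = v + subst1 (- q) u" by (simp add: subst1_uminus)
    then show ?thesis by blast
  next
    fix a b assume "v = v0 * (u + const_xy b) + const_xy a"
    then have "v + const_xy (- a) = v0 * (u + const_xy b)" by (simp add: const_xy_uminus)
    moreover have "u + const_xy b \<noteq> 0"
      using total_degree_pos(1)[OF that(1)] total_degree_add_const[of u b] by (auto simp: total_degree_eq)
    ultimately show ?thesis by blast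
  qed
  show ?thesis using assms(1)
  proof cases
    case base
    then show ?thesis using assms(2) by simp
  next
    case (right v0)
    have nz: "bracket u v0 \<noteq> 0" using right bracket_ascending by blast
    have "gen_contraction (u, v) (u, v0)" using *[OF nz right(2)]
    proof (elim disjE exE conjE)
      fix a b assume "u + const_xy b \<noteq> 0" "v + const_xy a = v0 * (u + const_xy b)"
      then show ?thesis using gen_contraction.ET1'[of 1 u b v a] by simp
    qed (simp add: gen_contraction.ET2')
    then show ?thesis using total_degree_elementary_lift[OF nz right(2)] nat_add_left_cancel_less by blast
  next
    case (left u0)
    have nz: "bracket v u0 \<noteq> 0" using bracket_ascending[OF left(1)] bracket_swap[of v u0] by simp
    have "gen_contraction (u, v) (u0, v)" using *[OF nz left(2)]
    proof (elim disjE exE conjE)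
      fix a b assume "v + const_xy b \<noteq> 0" "u + const_xy a = u0 * (v + const_xy b)"
      then show ?thesis using gen_contraction.ET1[of 1 v b u a] by simp
    qed (simp add: gen_contraction.ET2)
    then show ?thesis using total_degree_elementary_lift[OF nz left(2)] add_less_cancel_right by blast
  qed
qed



section \<open>Pairs of generators\<close>

definition subst2 :: "'a::field bpoly \<Rightarrow> 'a bpoly \<Rightarrow> 'a bpoly \<Rightarrow> 'a bpoly" where
  "subst2 G a b = poly (map_poly (\<lambda>q. subst1 q a) G) b"

lemma subst2_0 [simp]: "subst2 0 a b = 0" by (simp add: subst2_def)
lemma subst2_pCons: "subst2 (pCons q G) a b = subst1 q a + b * subst2 G a b"
  by (simp add: subst2_def map_poly_pCons)
lemma subst2_add: "subst2 (G + H) a b = subst2 G a b + subst2 H a b"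
  by (simp add: subst2_def map_poly_add_hom subst1_add)
lemma subst2_mult: "subst2 (G * H) a b = subst2 G a b * subst2 H a b"
  by (simp add: subst2_def map_poly_mult_hom subst1_add subst1_mult)
lemma subst2_pcompose: "subst2 (pcompose G H) a b = subst2 G a (subst2 H a b)"
  by (induction G) (simp_all add: pcompose_pCons subst2_pCons subst2_add subst2_mult)

lemma subst1_1: "subst1 1 a = 1"
  using subst1_const[of 1 a] by (simp add: one_pCons)

lemma subst2_translate: "\<exists>G'. subst2 G a b = subst2 G' a (b + subst1 q a)"
proof
  show "subst2 G a b = subst2 (pcompose G [:- q, 1:]) a (b + subst1 q a)"
    by (simp add: subst2_pcompose subst2_pCons subst1_uminus subst1_1)
qed

lemma subst2_swap: "\<exists>G'. subst2 G a b = subst2 G' b a"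
proof (induction G)
  case 0
  then show ?case by (intro exI[of _ 0]) simp
next
  case (pCons q G)
  then obtain G' where G': "subst2 G a b = subst2 G' b a" by blast
  have "subst2 (map_poly (\<lambda>c. [:c:]) q) b a = subst1 q a"
    by (induction q) (simp_all add: map_poly_pCons subst2_pCons subst1_pCons)
  moreover have "subst2 [:[:0, 1:]:] b a = b" by (simp add: subst2_pCons subst1_pCons)
  ultimately have "subst2 (map_poly (\<lambda>c. [:c:]) q + [:[:0, 1:]:] * G') b a = subst2 (pCons q G) a b"
    by (simp only: subst2_add subst2_mult subst2_pCons G')
  then show ?case by metis
qed

lemma alg_endo_0: "alg_endo f \<Longrightarrow> f 0 = 0"
  unfolding alg_endo_def by (metis const_xy_0)

lemma alg_endo_subst1:
  assumes "alg_endo f" shows "f (subst1 q a) = subst1 q (f a)"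
  using assms by (induction q) (simp_all add: alg_endo_0 alg_endo_def subst1_pCons)

lemma alg_endo_subst2:
  assumes "alg_endo f" shows "f (subst2 G a b) = subst2 G (f a) (f b)"
proof (induction G)
  case (pCons q G)
  have "f (subst2 (pCons q G) a b) = f (subst1 q a) + f b * f (subst2 G a b)"
    using assms by (simp add: alg_endo_def subst2_pCons)
  then show ?case using pCons by (simp add: alg_endo_subst1[OF assms] subst2_pCons)
qed (simp add: alg_endo_0 assms)

lemma subst2_vars: "subst2 G var_x var_y = G"
proof (induction G)
  case (pCons q G)
  have "subst1 q var_x = [:q:]"
    by (induction q) (simp_all add: subst1_pCons var_x_def const_xy_def)
  then show ?case using pCons by (simp add: subst2_pCons var_y_def)
qed simp

lemma alg_endo_eq_subst2: "alg_endo f \<Longrightarrow> f G = subst2 G (f var_x) (f var_y)"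
  by (metis alg_endo_subst2 subst2_vars)

text \<open>
  The chain rule for Jacobians, reduced to the divisibility that is used below.
\<close>
lemma dvd_bracket_subst2:
  assumes "d dvd bracket r a" "d dvd bracket r b"
  shows "d dvd bracket r (subst2 G a b)"
proof (induction G)
  case (pCons q G)
  have "d dvd bracket r (subst1 q a)"
    by (induction q) (use assms in \<open>auto simp: subst1_pCons bracket_add bracket_mult\<close>)
  then show ?case using pCons assms by (auto simp: subst2_pCons bracket_add bracket_mult)
qed simp

text \<open>
  The Jacobian of a generating pair divides that of \<open>(x, y)\<close>, so it is constant; the remaining
  degree \<open>1\<close> is that of the factor \<open>t\<close>.
\<close>
lemma degree_bracket_generators:
  assumes "var_x = subst2 G a b" "var_y = subst2 H a b"
  shows "degree (bracket a b) = 1"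
proof -
  let ?d = "bracket a b"
  have "?d dvd bracket a (subst2 H a b)" "?d dvd bracket b (subst2 H a b)"
    using bracket_swap[of a b] by (auto intro!: dvd_bracket_subst2)
  then have "?d dvd bracket (subst2 H a b) a" "?d dvd bracket (subst2 H a b) b"
    using bracket_swap[of "subst2 H a b"] by (simp_all add: bracket_swap[of "subst2 H a b"])
  then have "?d dvd bracket var_y var_x"
    unfolding assms by (rule dvd_bracket_subst2)
  then have "?d dvd bracket var_x var_y" by (metis dvd_minus_iff bracket_swap)
  then have d: "?d dvd [:0, 1:]" by (simp only: bracket_xy)
  then have "?d \<noteq> 0" by auto
  moreover have "degree ?d \<le> 1" using dvd_imp_degree_le[OF d] by simp
  ultimately show ?thesis using bracket_degree_pos[of a b] by linarith
qed

section \<open>A divisibility between the degrees of generators\<close>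

definition lin_comb :: "(nat \<times> nat \<Rightarrow> 'a::field) \<Rightarrow> (nat \<times> nat) set \<Rightarrow> 'a bpoly \<Rightarrow> 'a bpoly \<Rightarrow> 'a bpoly" where
  "lin_comb c S a b = (\<Sum>k\<in>S. const_xy (c k) * a ^ fst k * b ^ snd k)"

lemma poly_eq_sum_atMost:
  fixes x :: "'a::comm_ring_1"
  assumes "degree p \<le> n" shows "poly p x = (\<Sum>i\<le>n. coeff p i * x ^ i)"
  unfolding poly_altdef using assms
  by (intro sum.mono_neutral_left) (auto simp: coeff_eq_0)

lemma subst2_eq_lin_comb:
  obtains c S where "finite S" "\<And>k. k \<in> S \<Longrightarrow> c k \<noteq> 0" "subst2 G a b = lin_comb c S a b"
proof -
  define N where "N = Max (insert 0 ((\<lambda>j. degree (coeff G j)) ` {..degree G}))"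
  have N: "degree (coeff G j) \<le> N" for j
  proof (cases "j \<le> degree G")
    case True
    then show ?thesis unfolding N_def by (intro Max_ge) auto
  qed (simp add: coeff_eq_0)
  let ?c = "\<lambda>k. coeff (coeff G (snd k)) (fst k)"
  let ?A = "{..N} \<times> {..degree G}"
  have "subst1 q a = (\<Sum>i\<le>N. const_xy (coeff q i) * a ^ i)" if "degree q \<le> N" for q
    unfolding subst1_def using that order_trans[OF map_poly_degree_leq that]
    by (subst poly_eq_sum_atMost[of _ N]) (auto simp: coeff_map_poly)
  then have "subst2 G a b = (\<Sum>j\<le>degree G. (\<Sum>i\<le>N. const_xy (?c (i, j)) * a ^ i) * b ^ j)"
    unfolding subst2_def using N
    by (subst poly_eq_sum_atMost[OF map_poly_degree_leq]) (auto simp: coeff_map_poly)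
  also have "\<dots> = (\<Sum>i\<le>N. \<Sum>j\<le>degree G. const_xy (?c (i, j)) * a ^ i * b ^ j)"
    unfolding sum_distrib_right by (rule sum.swap)
  also have "\<dots> = lin_comb ?c ?A a b"
    unfolding lin_comb_def sum.cartesian_product by (simp add: case_prod_unfold)
  also have "\<dots> = lin_comb ?c {k \<in> ?A. ?c k \<noteq> 0} a b"
    unfolding lin_comb_def by (intro sum.mono_neutral_right) auto
  finally show ?thesis by (intro that[of "{k \<in> ?A. ?c k \<noteq> 0}" ?c]) auto
qed

lemma bracket_power_self [simp]: "bracket a (a ^ i) = 0"
  using bracket_const[of a 1] by (induction i) (simp_all add: bracket_mult)

lemma radial_power: "radial (a ^ i) = radial a ^ i"
  by (induction i) (simp_all add: radial_mult)

lemma bracket_power: "radial b * bracket a (b ^ j) = of_nat j * radial b ^ j * bracket a b"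
  using bracket_const[of a 1] by (induction j) (simp_all add: bracket_mult radial_power algebra_simps)

lemma bracket_sum: "bracket a (sum f S) = (\<Sum>k\<in>S. bracket a (f k))"
  by (induction S rule: infinite_finite_induct) (simp_all add: bracket_add)

lemma radial_sum: "radial (sum f S) = (\<Sum>k\<in>S. radial (f k))"
  by (induction S rule: infinite_finite_induct) (simp_all add: radial_add)

text \<open>
  The derivation \<open>J(a, _)\<close> kills \<open>a\<close>, so on polynomials in \<open>a, b\<close> the operator \<open>b J(a, _)\<close> equals
  \<open>J(a, b)\<close> times the Euler operator \<open>b \<partial>/\<partial>b\<close>, which multiplies a monomial by its exponent
  of \<open>b\<close>.
\<close>
lemma bracket_lin_comb:
  "radial b * bracket a (lin_comb c S a b)
    = radial (lin_comb (\<lambda>k. of_nat (snd k) * c k) S a b) * bracket a b"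
proof -
  have const: "radial (const_xy (of_nat j * d)) = of_nat j * radial (const_xy d)" for j and d :: 'a
    by (simp add: of_nat_poly)
  have "radial b * bracket a (const_xy d * a ^ i * b ^ j)
      = radial (const_xy (of_nat j * d) * a ^ i * b ^ j) * bracket a b" for d i j
  proof -
    have "radial b * bracket a (const_xy d * a ^ i * b ^ j)
        = radial (const_xy d * a ^ i) * (radial b * bracket a (b ^ j))"
      by (simp add: bracket_mult)
    then show ?thesis unfolding bracket_power radial_mult const radial_power by (simp only: ac_simps)
  qed
  then show ?thesis
    unfolding lin_comb_def bracket_sum radial_sum sum_distrib_left sum_distrib_right by simp
qed

text \<open>
  The operator \<open>b \<partial>/\<partial>b - l\<close> deletes the monomials with exponent \<open>l\<close> of \<open>b\<close>; by the preceding
  identity it raises the degree of the value by at most \<open>deg a + deg b - 2\<close>, however much the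
  values of the monomials cancel.
\<close>
lemma total_degree_euler_operator:
  fixes a b :: "'a::field_char_0 bpoly"
  assumes nz: "bracket a b \<noteq> 0"
  shows "total_degree (lin_comb (\<lambda>k. (of_nat (snd k) - of_nat l) * c k) S a b) + 2
      \<le> total_degree (lin_comb c S a b) + total_degree a + total_degree b"
proof -
  let ?h = "lin_comb c S a b" and ?h' = "lin_comb (\<lambda>k. (of_nat (snd k) - of_nat l) * c k) S a b"
  let ?J = "bracket a b"
  note pos = total_degree_pos[OF nz]
  note Jpos = bracket_degree_pos[OF nz]
  show ?thesis
  proof (cases "?h' = 0")
    case True
    then show ?thesis using pos by (simp add: total_degree_eq)
  next
    case False
    have split: "const_xy (of_nat j * d) = const_xy ((of_nat j - of_nat l) * d) + const_xy (of_nat l) * const_xy d"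
      for j and d :: 'a
      unfolding const_xy_mult[symmetric] const_xy_add[symmetric] by (simp add: algebra_simps)
    have "lin_comb (\<lambda>k. of_nat (snd k) * c k) S a b = ?h' + const_xy (of_nat l) * ?h"
      unfolding lin_comb_def sum_distrib_left sum.distrib[symmetric] split
      by (intro sum.cong refl) (simp only: algebra_simps)
    then have eq: "radial ?h' * ?J = radial b * bracket a ?h - radial (const_xy (of_nat l)) * radial ?h * ?J"
      unfolding bracket_lin_comb by (simp add: radial_add radial_mult algebra_simps)
    have 1: "degree (radial b * bracket a ?h) + 1 \<le> total_degree b + total_degree a + total_degree ?h"
    proof (cases "bracket a ?h = 0")
      case False
      then show ?thesis using degree_bracket_le[OF False] degree_mult_le[of "radial b" "bracket a ?h"]
        by (simp add: total_degree_eq)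
    qed (use pos in simp)
    have 2: "degree (radial (const_xy (of_nat l)) * radial ?h * ?J) \<le> total_degree ?h + degree ?J"
      by (rule order_trans[OF degree_mult_le add_mono]) (simp_all add: total_degree_eq)
    have 3: "degree (radial ?h' * ?J) = total_degree ?h' + degree ?J"
      using False nz by (simp add: degree_mult_eq total_degree_eq)
    have "degree (radial ?h' * ?J)
        \<le> max (degree (radial b * bracket a ?h)) (degree (radial (const_xy (of_nat l)) * radial ?h * ?J))"
      unfolding eq by (rule degree_diff_le_max)
    then show ?thesis using 1 2 3 Jpos pos by linarith
  qed
qed

lemma total_degree_power: "a \<noteq> 0 \<Longrightarrow> total_degree (a ^ i) = i * total_degree a"
  by (simp add: total_degree_eq radial_power degree_power_eq)

lemma total_degree_lin_comb_less:
  assumes "\<And>k. k \<in> S \<Longrightarrow> fst k * total_degree a + snd k * total_degree b < W" "0 < W"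
    "a \<noteq> 0" "b \<noteq> 0"
  shows "total_degree (lin_comb c S a b) < W"
proof -
  have "degree (radial (const_xy (c k) * a ^ fst k * b ^ snd k)) < W" if "k \<in> S" for k
  proof (cases "c k = 0")
    case False
    then show ?thesis using assms(1)[OF that] assms(3,4)
      unfolding total_degree_eq[symmetric] by (simp add: total_degree_mult total_degree_power)
  qed (use assms in simp)
  then show ?thesis
    unfolding lin_comb_def total_degree_eq radial_sum using assms(2)
    by (intro degree_sum_less) auto
qed

text \<open>
  Among the \<open>N + 1\<close> monomials of top weight \<open>W\<close>, one that is alone has no partner to cancel with,
  and then the value has degree \<open>W\<close>. Each application of an operator \<open>b \<partial>/\<partial>b - l\<close> removes exactly
  one of them, since the exponent of \<open>b\<close> determines that of \<open>a\<close> on the line of weight \<open>W\<close>.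
\<close>
lemma weighted_degree_bound:
  fixes a b :: "'a::field_char_0 bpoly"
  assumes nz: "bracket a b \<noteq> 0"
  defines "wt \<equiv> \<lambda>k. fst k * total_degree a + snd k * total_degree b"
  shows "finite S \<Longrightarrow> (\<And>k. k \<in> S \<Longrightarrow> c k \<noteq> 0 \<and> wt k \<le> W) \<Longrightarrow> card {k \<in> S. wt k = W} = Suc N
    \<Longrightarrow> W + 2 * N \<le> total_degree (lin_comb c S a b) + N * (total_degree a + total_degree b)"
proof (induction N arbitrary: c S)
  case 0
  note pos = total_degree_pos[OF nz]
  have ab: "a \<noteq> 0" "b \<noteq> 0" using nz bracket_swap[of a b] by auto
  obtain k where k: "{k \<in> S. wt k = W} = {k}" using 0(3) by (auto simp: card_1_singleton_iff)
  let ?t = "const_xy (c k) * a ^ fst k * b ^ snd k"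
  have kS: "k \<in> S" "wt k = W" using k by auto
  then have t: "total_degree ?t = W"
    using 0(2)[of k] ab by (simp add: total_degree_mult total_degree_power wt_def)
  show ?case
  proof (cases "W = 0")
    case False
    have "total_degree (lin_comb c (S - {k}) a b) < W"
    proof (rule total_degree_lin_comb_less)
      fix l assume "l \<in> S - {k}"
      then have "wt l \<noteq> W" "wt l \<le> W" using k 0(2) by auto
      then show "fst l * total_degree a + snd l * total_degree b < W" by (simp add: wt_def)
    qed (use ab False in auto)
    moreover have "lin_comb c S a b = ?t + lin_comb c (S - {k}) a b"
      unfolding lin_comb_def using kS 0(1) by (simp add: sum.remove)
    ultimately show ?thesis using t total_degree_add_left[of "lin_comb c (S - {k}) a b" ?t] by simp
  qed simp
next
  case (Suc N)
  note pos = total_degree_pos[OF nz]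
  let ?M = "{k \<in> S. wt k = W}"
  have "?M \<noteq> {}" using Suc.prems(3) by (metis card.empty nat.distinct(1))
  then obtain k0 where k0: "k0 \<in> ?M" by blast
  define c' where "c' = (\<lambda>k. (of_nat (snd k) - of_nat (snd k0)) * c k)"
  define S' where "S' = {k \<in> S. snd k \<noteq> snd k0}"
  have "{k \<in> S'. wt k = W} = ?M - {k0}"
  proof -
    have "k = k0" if "wt k = W" "snd k = snd k0" for k
      using that k0 pos(1) by (auto simp: wt_def prod_eq_iff)
    then show ?thesis unfolding S'_def by auto
  qed
  then have "card {k \<in> S'. wt k = W} = Suc N" using Suc.prems(1,3) k0 by simp
  moreover have "finite S'" "\<And>k. k \<in> S' \<Longrightarrow> c' k \<noteq> 0 \<and> wt k \<le> W"
    using Suc.prems(1,2) unfolding S'_def c'_def by auto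
  ultimately have IH: "W + 2 * N \<le> total_degree (lin_comb c' S' a b) + N * (total_degree a + total_degree b)"
    using Suc.IH[of S' c'] by blast
  have "lin_comb c' S' a b = lin_comb c' S a b"
    unfolding lin_comb_def S'_def c'_def using Suc.prems(1) by (intro sum.mono_neutral_left) auto
  then have "total_degree (lin_comb c' S' a b) + 2 \<le> total_degree (lin_comb c S a b) + total_degree a + total_degree b"
    using total_degree_euler_operator[OF nz, of "snd k0" c S] unfolding c'_def by simp
  then show ?case using IH by simp
qed

text \<open>
  On a line \<open>i n + j m = W\<close> the values of \<open>j\<close> are congruent modulo \<open>n / gcd n m\<close>, so distinct points
  differ by at least \<open>lcm n m\<close> in the summand \<open>j m \<le> W\<close>.
\<close>
lemma card_lattice_segment:
  fixes n m W :: nat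
  assumes "n > 0" "m > 0" and M: "\<And>k. k \<in> M \<Longrightarrow> fst k * n + snd k * m = W"
  shows "(card M - 1) * lcm n m \<le> W"
proof -
  define g where "g = gcd n m"
  define p s where "p = n div g" and "s = m div g"
  have g: "g > 0" "n = p * g" "m = s * g" "coprime p s"
    using assms unfolding g_def p_def s_def by (auto simp: div_gcd_coprime)
  then have ps: "p > 0" "s > 0" using assms by auto
  have lcm: "lcm n m = m * p"
  proof -
    have "g * lcm n m = n * m" using prod_gcd_lcm_nat[of n m] by (simp add: g_def)
    also have "\<dots> = g * (m * p)" by (simp only: g(2) ac_simps)
    finally show ?thesis using g(1) by simp
  qed
  have inj: "inj_on (\<lambda>k. snd k div p) M"
  proof (rule inj_onI)
    fix k l assume kl: "k \<in> M" "l \<in> M" and eq: "snd k div p = snd l div p"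
    have "fst k * p + snd k * s = fst l * p + snd l * s"
    proof -
      have "(fst k * p + snd k * s) * g = (fst l * p + snd l * s) * g"
        using M[OF kl(1)] M[OF kl(2)] g by (simp add: algebra_simps)
      then show ?thesis using g by simp
    qed
    then have "(int (snd k) - int (snd l)) * int s = (int (fst l) - int (fst k)) * int p"
      by (simp add: algebra_simps flip: of_nat_mult of_nat_add)
    then have "int p dvd (int (snd k) - int (snd l)) * int s" by simp
    then have "int p dvd int (snd k) - int (snd l)"
      using g(4) by (simp add: coprime_dvd_mult_left_iff)
    then have "snd k mod p = snd l mod p"
      by (metis mod_eq_dvd_iff zmod_int of_nat_eq_iff)
    then have s: "snd k = snd l" using eq by (metis div_mult_mod_eq)
    then have "fst k * n = fst l * n" using M[OF kl(1)] M[OF kl(2)] by (metis add_right_cancel)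
    then have "fst k = fst l" using assms(1) by simp
    with s show "k = l" by (simp add: prod_eq_iff)
  qed
  have sub: "(\<lambda>k. snd k div p) ` M \<subseteq> {..W div lcm n m}"
  proof (rule image_subsetI)
    fix k assume "k \<in> M"
    then have "snd k * m \<le> W" using M[of k] by linarith
    then have "snd k \<le> W div m" using assms by (simp add: less_eq_div_iff_mult_less_eq)
    then show "snd k div p \<in> {..W div lcm n m}" by (simp add: lcm div_mult2_eq div_le_mono)
  qed
  then have "card M \<le> W div lcm n m + 1"
    using card_image[OF inj] card_mono[OF finite_atMost sub] by simp
  then have "(card M - 1) * lcm n m \<le> (W div lcm n m) * lcm n m" by (intro mult_right_mono) auto
  then show ?thesis using div_times_less_eq_dividend[of W "lcm n m"] by linarith
qed

text \<open>
  The two estimates above give \<open>N (lcm n m - n - m + 2) \<le> 1\<close> for \<open>n = deg a\<close> and \<open>m = deg b\<close>. If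
  neither degree divides the other, then \<open>lcm n m\<close> is at least twice each of them, which forces
  \<open>N = 0\<close> and then \<open>W \<le> 1\<close>, so that one of the degrees is \<open>1\<close>.
\<close>
lemma degrees_dvd:
  fixes a b :: "'a::field_char_0 bpoly"
  assumes nz: "bracket a b \<noteq> 0" and x: "var_x = subst2 G a b"
  shows "total_degree a dvd total_degree b \<or> total_degree b dvd total_degree a"
proof -
  let ?n = "total_degree a" and ?m = "total_degree b"
  let ?wt = "\<lambda>k. fst k * ?n + snd k * ?m"
  note pos = total_degree_pos[OF nz]
  obtain c S where S: "finite S" "\<And>k. k \<in> S \<Longrightarrow> c k \<noteq> 0" "var_x = lin_comb c S a b"
    using subst2_eq_lin_comb[of G a b] x by metis
  have td1: "total_degree (var_x :: 'a bpoly) = 1" by (simp add: total_degree_eq)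
  define W where "W = Max (?wt ` S)"
  have "S \<noteq> {}" using S(3) by (auto simp: lin_comb_def var_x_def)
  then have W: "W \<in> ?wt ` S" "\<And>k. k \<in> S \<Longrightarrow> ?wt k \<le> W" unfolding W_def using S(1) by auto
  have W0: "W > 0"
  proof (rule ccontr)
    assume "\<not> W > 0"
    then have "fst k = 0 \<and> snd k = 0" if "k \<in> S" for k using W(2)[OF that] pos by auto
    then have "S \<subseteq> {(0, 0)}" by (auto simp: prod_eq_iff)
    then have "var_x = const_xy (c (0, 0))" using \<open>S \<noteq> {}\<close> S(3) by (simp add: lin_comb_def subset_singleton_iff)
    then show False using td1 total_degree_const[of "c (0, 0)"] by (metis zero_neq_one)
  qed
  let ?M = "{k \<in> S. ?wt k = W}"
  obtain k where "k \<in> S" "?wt k = W" using W(1) by blast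
  then have "?M \<noteq> {}" by blast
  then have "card ?M \<noteq> 0" using S(1) by simp
  then obtain N where N: "card ?M = Suc N" by (rule not0_implies_Suc[THEN exE])
  have "W + 2 * N \<le> total_degree (lin_comb c S a b) + N * (?n + ?m)"
    by (rule weighted_degree_bound[OF nz S(1) _ N]) (use S(2) W(2) in blast)
  then have A: "W + 2 * N \<le> 1 + N * (?n + ?m)" using S(3) td1 by simp
  have B: "N * lcm ?n ?m \<le> W"
    using card_lattice_segment[OF pos, of ?M W] unfolding N by simp
  show ?thesis
  proof (cases "N = 0")
    case True
    then have W1: "W = 1" using A W0 by simp
    then obtain k where "?wt k = 1" using W(1) by auto
    then have "?n = 1 \<or> ?m = 1" by (auto simp: add_is_1)
    then show ?thesis by auto
  next
    case False
    have "N * (lcm ?n ?m + 2) \<le> N * (1 + ?n + ?m)"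
      using A B False by (simp add: algebra_simps)
    then have "lcm ?n ?m + 2 \<le> 1 + ?n + ?m" using False by (simp only: mult_le_cancel1)
    then have lt: "lcm ?n ?m < ?n + ?m" by simp
    show ?thesis
    proof (rule ccontr)
      assume no: "\<not> ?thesis"
      obtain r where r: "lcm ?n ?m = ?n * r" by (metis dvd_def dvd_lcm1)
      obtain t where t: "lcm ?n ?m = ?m * t" by (metis dvd_def dvd_lcm2)
      have "lcm ?n ?m > 0" using pos by (simp add: lcm_pos_nat)
      then have "r \<noteq> 0" "t \<noteq> 0" using r t by (metis mult_0_right less_irrefl)+
      moreover have "r \<noteq> 1" "t \<noteq> 1" using no r t by (metis dvd_lcm1 dvd_lcm2 mult.right_neutral)+
      ultimately have rt: "r \<ge> 2" "t \<ge> 2" by auto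
      have "?n * 2 \<le> lcm ?n ?m" unfolding r using rt(1) by simp
      moreover have "?m * 2 \<le> lcm ?n ?m" unfolding t using rt(2) by simp
      ultimately show False using lt by linarith
    qed
  qed
qed

section \<open>Lowering the degree of a pair of generators\<close>

lemma wronskian_degree_eq:
  fixes f g :: "'a::field_char_0 poly"
  assumes "f * pderiv g = pderiv f * g" "f \<noteq> 0" "g \<noteq> 0"
  shows "degree g = degree f"
proof (cases "degree f = 0 \<or> degree g = 0")
  case True
  then show ?thesis using assms pderiv_eq_0_iff[of f] pderiv_eq_0_iff[of g] by auto
next
  case False
  then have "coeff (pderiv h) (degree (pderiv h)) = of_nat (degree h) * lead_coeff h"
    if "h \<in> {f, g}" for h using that by (auto simp: coeff_pderiv degree_pderiv)
  then have "lead_coeff (f * pderiv g) = lead_coeff f * (of_nat (degree g) * lead_coeff g)"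
    "lead_coeff (pderiv f * g) = of_nat (degree f) * lead_coeff f * lead_coeff g"
    unfolding lead_coeff_mult by simp_all
  then have "of_nat (degree g) * (lead_coeff f * lead_coeff g) = of_nat (degree f) * (lead_coeff f * lead_coeff g)"
    using assms(1) by (simp add: ac_simps)
  then show ?thesis using assms by simp
qed

text \<open>
  Subtracting a multiple of \<open>f\<close> that kills the coefficient of index \<open>degree f\<close> preserves the
  vanishing of the Wronskian, and by the equality of degrees nothing is left.
\<close>
lemma wronskian_proportional:
  fixes f g :: "'a::field_char_0 poly"
  assumes "f * pderiv g = pderiv f * g" "f \<noteq> 0"
  obtains c where "g = smult c f"
proof -
  define c where "c = coeff g (degree f) / lead_coeff f"
  define h where "h = g - smult c f"
  have "f * pderiv h = pderiv f * h"
    using assms(1) by (simp add: h_def pderiv_diff pderiv_smult algebra_simps)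
  moreover have "coeff h (degree f) = 0" using assms(2) by (simp add: h_def c_def)
  ultimately have "h = 0" using wronskian_degree_eq[of f h] assms(2) by (metis leading_coeff_0_iff)
  then show ?thesis using that unfolding h_def by simp
qed

lemma subst1_monom: "subst1 (monom c s) a = const_xy c * a ^ s"
  by (simp add: subst1_def map_poly_monom poly_monom)

text \<open>
  A constant Jacobian has no room for the top coefficient computed in \<open>coeff_bracket_top\<close> once the
  degrees sum to more than \<open>2\<close>. So, with \<open>s = deg b / deg a\<close>, the leading form of \<open>b\<close> and the \<open>s\<close>-th
  power of that of \<open>a\<close> have vanishing Wronskian, and \<open>q = - c X\<^sup>s\<close> cancels the former.
\<close>
lemma top_form_cancel:
  fixes a b :: "'a::field_char_0 bpoly"
  assumes deg: "degree (bracket a b) = 1" and big: "total_degree a + total_degree b > 2"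
    and dvd: "total_degree a dvd total_degree b"
  obtains q where "total_degree (b + subst1 q a) < total_degree b"
proof -
  let ?n = "total_degree a" and ?m = "total_degree b"
  have nz: "bracket a b \<noteq> 0" using deg by auto
  note pos = total_degree_pos[OF nz]
  obtain s where s: "?m = s * ?n" using dvd by (metis dvd_def mult.commute)
  then have s0: "s > 0" using pos by (cases s) auto
  let ?f = "lead_coeff (radial a)" and ?g = "lead_coeff (radial b)"
  have f0: "?f \<noteq> 0" using pos by (auto simp: total_degree_eq)
  have "coeff (bracket a b) (?n + ?m - 1) = 0" using deg big by (intro coeff_eq_0) simp
  then have "of_nat ?n * ?f * pderiv ?g = of_nat ?m * pderiv ?f * ?g"
    using coeff_bracket_top[OF refl refl pos] by simp
  then have "of_nat ?n * (?f * pderiv ?g) = of_nat ?n * (of_nat s * pderiv ?f * ?g)"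
    unfolding s by (simp add: ac_simps)
  then have w: "?f * pderiv ?g = of_nat s * pderiv ?f * ?g" using pos by simp
  have "?f ^ s * pderiv ?g = pderiv (?f ^ s) * ?g"
  proof -
    obtain r where r: "s = Suc r" using s0 by (cases s) auto
    have "pderiv (?f ^ s) = of_nat s * ?f ^ r * pderiv ?f"
      unfolding r pderiv_power_Suc by (simp add: of_nat_poly)
    moreover have "?f ^ s * pderiv ?g = ?f ^ r * (?f * pderiv ?g)" by (simp add: r)
    ultimately show ?thesis unfolding w by (simp add: ac_simps)
  qed
  then obtain c where c: "?g = smult c (?f ^ s)"
    using wronskian_proportional[of "?f ^ s" ?g] f0 by auto
  define b' where "b' = b + subst1 (monom (- c) s) a"
  have rb: "radial b' = radial b + smult [:- c:] (radial a ^ s)"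
    unfolding b'_def subst1_monom radial_add radial_mult by (simp add: radial_power)
  have ds: "degree (radial a ^ s) = ?m" using f0 s by (simp add: degree_power_eq total_degree_eq)
  have "coeff (radial a ^ s) ?m = ?f ^ s" using lead_coeff_power[of "radial a" s] ds by simp
  then have "coeff (radial b') ?m = 0"
    unfolding rb using c by (simp add: total_degree_eq[of b])
  moreover have "degree (radial b') \<le> ?m"
    unfolding rb using ds by (intro degree_add_le) (auto simp: total_degree_eq intro: order_trans[OF degree_smult_le])
  ultimately have "total_degree b' < ?m"
    using pos(2) unfolding total_degree_eq[of b'] by (metis le_neq_implies_less leading_coeff_0_iff degree_0)
  then show ?thesis using that unfolding b'_def by blast
qed

lemma total_degree_le_1E:
  assumes "total_degree p \<le> 1"
  obtains r s t where "p = const_xy r + const_xy s * var_x + const_xy t * var_y"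
proof
  have z: "coeff (coeff p j) i = 0" if "i + j > 1" for i j
    using that assms coeff_radial[of p "i + j" j] by (simp add: total_degree_eq coeff_eq_0)
  show "p = const_xy (coeff (coeff p 0) 0) + const_xy (coeff (coeff p 0) 1) * var_x
      + const_xy (coeff (coeff p 1) 0) * var_y"
    by (intro poly_eqI)
      (auto simp: const_xy_def var_x_def var_y_def coeff_pCons z split: nat.split)
qed

section \<open>Products of contractions give ascending pairs\<close>

lemma ascending_affine_aux:
  assumes asc: "ascending p q" and s: "s \<noteq> 0" and det: "s * t' - t * s' \<noteq> 0"
  shows "ascending (const_xy r + const_xy s * p + const_xy t * q)
    (const_xy r' + const_xy s' * p + const_xy t' * q)"
proof -
  define P where "P = const_xy s * p + subst1 [:r, t:] q"
  have P: "P = const_xy r + const_xy s * p + const_xy t * q"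
    by (simp add: P_def subst1_pCons algebra_simps)
  define d where "d = t' - s' * t / s"
  have "d \<noteq> 0" using s det by (simp add: d_def field_simps)
  have "ascending q P" unfolding P_def
    by (intro ascending_add ascending_scale ascending_swap[OF asc] s)
  then have "ascending P (const_xy d * q + subst1 [:r' - s' * r / s, s' / s:] P)"
    by (intro ascending_add ascending_scale ascending_swap[of q P] \<open>d \<noteq> 0\<close>)
  moreover have "const_xy d * q + subst1 [:r' - s' * r / s, s' / s:] P
      = const_xy r' + const_xy s' * p + const_xy t' * q"
  proof -
    have k: "const_xy (1 / s) * const_xy s = 1" using s by (simp flip: const_xy_mult)
    have k1: "const_xy d = const_xy t' - const_xy s' * const_xy t * const_xy (1 / s)"
      unfolding const_xy_mult[symmetric] by (simp add: d_def const_xy_def)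
    have k2: "const_xy (r' - s' * r / s) = const_xy r' - const_xy s' * const_xy r * const_xy (1 / s)"
      unfolding const_xy_mult[symmetric] by (simp add: const_xy_def)
    have k3: "const_xy (s' / s) = const_xy s' * const_xy (1 / s)"
      unfolding const_xy_mult[symmetric] by simp
    show ?thesis unfolding subst1_pCons k1 k2 k3 P subst1_0 using k by algebra
  qed
  ultimately show ?thesis by (simp add: P)
qed

lemma ascending_affine:
  assumes asc: "ascending p q" and det: "s * t' - t * s' \<noteq> 0"
  shows "ascending (const_xy r + const_xy s * p + const_xy t * q)
    (const_xy r' + const_xy s' * p + const_xy t' * q)"
proof (cases "s = 0")
  case False
  then show ?thesis using ascending_affine_aux assms by blast
next
  case True
  then have "t \<noteq> 0" "t * s' - s * t' \<noteq> 0" using det by auto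
  then show ?thesis
    using ascending_affine_aux[OF ascending_swap[OF asc], of t s' s t' r r'] by (simp add: ac_simps)
qed

lemma bracket_affine:
  "bracket (const_xy r + const_xy s * var_x + const_xy t * var_y)
    (const_xy r' + const_xy s' * var_x + const_xy t' * var_y)
    = radial (const_xy (s * t' - t * s')) * bracket var_x var_y" (is "bracket ?a ?b = _")
proof -
  have x: "bracket ?a var_x = - (radial (const_xy t) * bracket var_x var_y)"
    unfolding bracket_swap[of ?a var_x] by (simp add: bracket_add bracket_mult)
  have y: "bracket ?a var_y = radial (const_xy s) * bracket var_x var_y"
    unfolding bracket_swap[of ?a var_y] by (simp add: bracket_add bracket_mult bracket_swap[of var_y var_x])
  have "bracket ?a ?b = radial (const_xy s') * bracket ?a var_x + radial (const_xy t') * bracket ?a var_y"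
    by (simp only: bracket_add bracket_mult bracket_const) simp
  moreover have "radial (const_xy (s * t' - t * s'))
      = radial (const_xy s) * radial (const_xy t') - radial (const_xy t) * radial (const_xy s')"
    by simp
  ultimately show ?thesis unfolding x y by algebra
qed

text \<open>
  Elementary moves of \<open>(a, b)\<close> that lower its degree become elementary moves of \<open>(\<psi> a, \<psi> b)\<close>, whose
  degrees may behave in any way; this is why ascending pairs have to be closed under all moves.
  Of an automorphism the induction retains only that the bracket has degree \<open>1\<close> and that \<open>x\<close> is a
  polynomial in \<open>a\<close> and \<open>b\<close>, two properties that survive the moves.
\<close>
lemma ascending_automorphism:
  fixes a b :: "'a::field_char_0 bpoly"
  assumes \<psi>: "alg_endo \<psi>" and asc: "ascending (\<psi> var_x) (\<psi> var_y)"
  shows "degree (bracket a b) = 1 \<Longrightarrow> \<exists>G. var_x = subst2 G a b \<Longrightarrow> ascending (\<psi> a) (\<psi> b)"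
proof (induction "total_degree a + total_degree b" arbitrary: a b rule: less_induct)
  case less
  have hom: "\<psi> (p + q) = \<psi> p + \<psi> q" "\<psi> (p * q) = \<psi> p * \<psi> q" "\<psi> (const_xy d) = const_xy d" for p q d
    using \<psi> unfolding alg_endo_def by auto
  have nz: "bracket a b \<noteq> 0" using less.prems by auto
  note pos = total_degree_pos[OF nz]
  have step: "ascending (\<psi> a') (\<psi> b')"
    if sum: "total_degree a' + total_degree b' = total_degree a + total_degree b"
      and deg: "degree (bracket a' b') = 1" and gen: "\<exists>G. var_x = subst2 G a' b'"
      and dvd: "total_degree a' dvd total_degree b'" and big: "total_degree a + total_degree b > 2"
    for a' b'
  proof -
    obtain q where q: "total_degree (b' + subst1 q a') < total_degree b'"
      using top_form_cancel[OF deg _ dvd] big sum by auto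
    have "ascending (\<psi> a') (\<psi> (b' + subst1 q a'))"
    proof (rule less.hyps)
      show "\<exists>G. var_x = subst2 G a' (b' + subst1 q a')" using gen subst2_translate by metis
    qed (use q sum deg in \<open>simp_all add: bracket_add_subst1\<close>)
    then have "ascending (\<psi> a') (\<psi> (b' + subst1 q a') + subst1 (- q) (\<psi> a'))" by (rule ascending_add)
    then show ?thesis by (simp add: hom alg_endo_subst1[OF \<psi>] subst1_uminus)
  qed
  show ?case
  proof (cases "total_degree a + total_degree b > 2")
    case True
    have "degree (bracket b a) = 1" using less.prems(1) bracket_swap[of a b] by simp
    moreover have "\<exists>G. var_x = subst2 G b a" using less.prems(2) subst2_swap by metis
    moreover have "total_degree a dvd total_degree b \<or> total_degree b dvd total_degree a"
      using degrees_dvd[OF nz] less.prems(2) by blast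
    ultimately show ?thesis
      using step[OF refl less.prems _ True] step[OF add.commute _ _ _ True] ascending_swap by metis
  next
    case False
    then have "total_degree a \<le> 1" "total_degree b \<le> 1" using pos by simp_all
    then obtain r s t r' s' t' where
      a: "a = const_xy r + const_xy s * var_x + const_xy t * var_y" and
      b: "b = const_xy r' + const_xy s' * var_x + const_xy t' * var_y"
      by (elim total_degree_le_1E)
    have "s * t' - t * s' \<noteq> 0" using nz unfolding a b bracket_affine by auto
    then show ?thesis unfolding a b hom using ascending_affine[OF asc] by blast
  qed
qed

lemma ascending_contraction:
  assumes \<psi>: "alg_endo \<psi>" and asc: "ascending (\<psi> var_x) (\<psi> var_y)"
    and f: "simple_affine_contraction f"
  shows "ascending (\<psi> (f var_x)) (\<psi> (f var_y))"
  using f unfolding simple_affine_contraction_def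
proof
  assume "alg_auto f"
  then have f: "alg_endo f" "bij f" unfolding alg_auto_def by auto
  have gen: "p = subst2 (inv f p) (f var_x) (f var_y)" for p
  proof -
    have "f (inv f p) = p" using f(2) by (simp add: bij_is_surj surj_f_inv_f)
    from trans[OF this[symmetric] alg_endo_eq_subst2[OF f(1)]] show ?thesis .
  qed
  show ?thesis
    by (rule ascending_automorphism[OF \<psi> asc degree_bracket_generators[OF gen gen]])
      (rule exI, rule gen)
next
  assume f: "f = tau_x"
  have "\<psi> (f var_y) = \<psi> var_y * (\<psi> var_x + const_xy 0) + const_xy 0"
    using \<psi> by (simp add: f tau_x_var_y alg_endo_def mult.commute)
  then have "elementary_lift (\<psi> var_x) (\<psi> var_y) (\<psi> (f var_y))" unfolding elementary_lift_def by blast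
  then show ?thesis using ascending.right[OF asc] by (simp add: f tau_x_var_x)
qed

text \<open>
  A product is decomposed from its outermost factor on, and an ascending pair for the outer factors
  is extended by the next inner one; the homomorphism \<open>\<psi>\<close> collects the outer factors already treated.
\<close>
lemma ascending_product:
  assumes "product_of_contractions g"
  shows "alg_endo \<psi> \<Longrightarrow> ascending (\<psi> var_x) (\<psi> var_y) \<Longrightarrow> ascending (\<psi> (g var_x)) (\<psi> (g var_y))"
  using assms
proof (induction arbitrary: \<psi> rule: product_of_contractions.induct)
  case (single f)
  then show ?case using ascending_contraction by blast
next
  case (comp f g)
  have "alg_endo f" using comp.hyps(1) alg_endo_tau_x
    unfolding simple_affine_contraction_def alg_auto_def by auto
  then have "alg_endo (\<psi> \<circ> f)" using comp.prems(1) by (simp add: alg_endo_def)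
  moreover have "ascending ((\<psi> \<circ> f) var_x) ((\<psi> \<circ> f) var_y)"
    using ascending_contraction[OF comp.prems comp.hyps(1)] by simp
  ultimately have "ascending ((\<psi> \<circ> f) (g var_x)) ((\<psi> \<circ> f) (g var_y))" by (rule comp.IH)
  then show ?case by simp
qed

theorem proposition1p2:
  fixes \<phi> :: "'a::field_char_0 bpoly \<Rightarrow> 'a bpoly"
    and u v :: "'a bpoly"
  assumes "birational_morphism \<phi>"
    and "\<phi> var_x = u" and "\<phi> var_y = v"
    and "product_of_contractions \<phi>"
    and "total_degree u + total_degree v > 2"
  shows "\<exists>u' v'. gen_contraction (u, v) (u', v') \<and>
           total_degree u' + total_degree v' < total_degree u + total_degree v"
proof (rule ascending_reducible)
  have "ascending var_x (var_y :: 'a bpoly)"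
    by (intro ascending.base) (simp_all add: total_degree_eq bracket_xy)
  then show "ascending u v"
    using ascending_product[OF assms(4), of id] assms(2,3) by (simp add: alg_endo_def)
qed (rule assms)

end
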